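(* Let $A\in\mathbb{R}^{n\times n}$ and $u,v\in\mathbb{R}^n$, and let $Q(\lambda)=v^\top(\lambda I_n-A)^{-1}u$. Suppose that for some $\tau_0>0$ an analytic definition of the eigenvalues of $A+\tau uv^\top$ is not possible due to $$Q(x)=1/\tau_0,\quad Q'(x)=0,\quad Q''(x)\neq0$$ for some $x\in\mathbb{R}$ which is not an eigenvalue of $A$. Then for all $\tilde A\in\mathbb{R}^{n\times n}$, $\tilde u\in\mathbb{R}^n$, $\tilde v\in\mathbb{R}^n$ with $\|\tilde v-v\|$, $\|\tilde u-u\|$ and $\|\tilde A-A\|$ sufficiently small, the analytic definition of the eigenvalues of $\tilde A+\tau\tilde u\tilde v^*$ is not possible due to the existence of $\tilde x\in\mathbb{R}$ and $\tilde\tau_0>0$, depending continuously on $\tilde A,\tilde u,\tilde v$, with $$\widetilde Q(\tilde x)=1/\tilde\tau_0,\quad \widetilde Q'(\tilde x)=0,\quad \widetilde Q''(\tilde x)\neq0,$$ where $\widetilde Q(\lambda)=\tilde v^*(\lambda I_n-\tilde A)^{-1}\tilde u$.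
   Context: For real vectors $\tilde v^*=\tilde v^\top$. Background on the phrase "analytic definition is not possible": if $\lambda_0$ is not an eigenvalue of $A$, then $\lambda_0$ is an eigenvalue of $A+\tau_0uv^*$ of algebraic multiplicity $\kappa$ if and only if $Q(\lambda_0)=1/\tau_0$, $Q'(\lambda_0)=\dots=Q^{(\kappa-1)}(\lambda_0)=0$, $Q^{(\kappa)}(\lambda_0)\neq0$. If $\kappa=1$ the eigenvalue of $A+\tau uv^*$ near $\lambda_0$ is an analytic function of $\tau$ near $\tau_0$. If $\kappa>1$ the eigenvalues near $\lambda_0$ cannot be given by analytic functions of $\tau$ in a neighbourhood of $\tau_0$; they expand in Puiseux series, behaving locally as the solutions of $(\lambda-\lambda_0)^\kappa=\tau-\tau_0$. The displayed conditions in the claim are the case $\kappa=2$. *)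

theory Defs
  imports "HOL-Analysis.Analysis"
begin

definition eigenvalue :: "'a::field^'n^'n \<Rightarrow> 'a \<Rightarrow> bool"
  where "eigenvalue A l \<longleftrightarrow> (\<exists>w. w \<noteq> 0 \<and> A *v w = l *s w)"

definition rank_one :: "real^'n \<Rightarrow> real^'n \<Rightarrow> real^'n^'n"
  where "rank_one u v = (\<chi> i j. u $ i * v $ j)"

text \<open>The function \<open>Q\<close> is only meaningful off the spectrum of \<open>A\<close>, where \<open>mat l - A\<close> is
  invertible. Its restriction to the real line suffices: \<open>Q\<close> is a rational function with real
  coefficients, and it is only evaluated and differentiated at real points.\<close>
definition Q :: "real^'n^'n \<Rightarrow> real^'n \<Rightarrow> real^'n \<Rightarrow> real \<Rightarrow> real"
  where "Q A u v l = v \<bullet> (matrix_inv (mat l - A) *v u)"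

text \<open>The (complex) eigenvalues near \<open>l0\<close> of the real matrix family \<open>M\<close> are given by finitely many
  analytic functions of the real parameter \<open>t\<close> near \<open>t0\<close>. A complex-valued function that is
  real-analytic near \<open>t0\<close> is the same thing as the restriction to the real line of a function
  holomorphic near \<open>t0\<close>. Multiplicities are not prescribed; an analytic enumeration of the
  eigenvalues with multiplicity is in particular one in the present sense, so that the negation of
  this predicate excludes both.\<close>
definition analytic_eigenvalues_near :: "(real \<Rightarrow> real^'n^'n) \<Rightarrow> real \<Rightarrow> complex \<Rightarrow> bool"
  where "analytic_eigenvalues_near M t0 l0 \<longleftrightarrow>
    (\<exists>(k::nat) (\<Lambda> :: nat \<Rightarrow> complex \<Rightarrow> complex) r. r > 0 \<and>
      (\<forall>i<k. \<Lambda> i analytic_on {complex_of_real t0}) \<and>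
      (\<forall>\<^sub>F t in nhds t0.
        {l \<in> ball l0 r. eigenvalue (map_matrix complex_of_real (M t)) l} =
        {\<Lambda> i (complex_of_real t) | i. i < k}))"

end

theory Submission
  imports Defs
begin

text \<open>Off the spectrum \<open>Q\<close> and its derivatives are jointly continuous in the data and \<open>l\<close>. As
  \<open>Q'\<close> vanishes at \<open>x\<close> with nonzero slope \<open>Q''\<close>, its zero persists and moves continuously
  with the data, and \<open>1 / Q\<close> at this zero is the new parameter. At such a critical point the
  parameter is stationary as a function of the eigenvalue, so no eigenvalue branch is
  differentiable in the parameter.\<close>

section \<open>Resolvents\<close>

lemma mat_diff_vector_mult:
  fixes A :: "real^'n^'n"
  shows "(mat l - A) *v w = l *s w - A *v w"
proof -
  have "mat l *v w = l *s w"
    by (simp add: vec_eq_iff matrix_vector_mult_def mat_def if_distrib[of "\<lambda>a. a * b" for b]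
        cong: if_cong)
  then show ?thesis
    by (simp add: matrix_vector_mult_diff_rdistrib)
qed

text \<open>An eigenvector is a nonzero kernel vector of \<open>mat l - A\<close>. The determinant
  form makes being off the spectrum an open condition in \<open>l\<close> and in
  \<open>A\<close>.\<close>

lemma eigenvalue_iff_det:
  fixes A :: "real^'n^'n"
  shows "eigenvalue A l \<longleftrightarrow> det (mat l - A) = 0"
proof -
  have "(mat l - A) *v w = 0 \<longleftrightarrow> A *v w = l *s w" for w
    by (metis mat_diff_vector_mult eq_iff_diff_eq_0)
  then show ?thesis
    using invertible_det_nz[of "mat l - A"] invertible_left_inverse[of "mat l - A"]
      matrix_left_invertible_ker[of "mat l - A"]
    by (auto simp: eigenvalue_def)
qed

lemma matrix_inv_vector:
  fixes M :: "real^'n^'n"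
  assumes "det M \<noteq> 0"
  shows "M *v (matrix_inv M *v b) = b" "matrix_inv M *v (M *v b) = b"
proof -
  have "\<exists>M'. M ** M' = mat 1 \<and> M' ** M = mat 1"
    using assms invertible_det_nz invertible_def by metis
  then have "M ** matrix_inv M = mat 1 \<and> matrix_inv M ** M = mat 1"
    unfolding matrix_inv_def by (rule someI_ex)
  then show "M *v (matrix_inv M *v b) = b" "matrix_inv M *v (M *v b) = b"
    by (simp_all add: matrix_vector_mul_assoc)
qed

lemma continuous_on_det:
  fixes M :: "'a::topological_space \<Rightarrow> real^'n^'n"
  assumes "continuous_on S M"
  shows "continuous_on S (\<lambda>z. det (M z))"
  unfolding det_def by (intro continuous_intros assms)

text \<open>Since \<open>matrix_inv\<close> is defined by choice, continuity is read off from
  Cramer's rule: each coordinate of the solution is a quotient of two determinants, with nonzero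
  denominator on \<open>S\<close>.\<close>

lemma continuous_on_matrix_inv_vector:
  fixes M :: "'a::topological_space \<Rightarrow> real^'n^'n"
  assumes "continuous_on S M" "continuous_on S b" "\<And>z. z \<in> S \<Longrightarrow> det (M z) \<noteq> 0"
  shows "continuous_on S (\<lambda>z. matrix_inv (M z) *v b z)"
proof -
  have "continuous_on S (\<lambda>z. (\<chi> k. det (\<chi> i j. if j = k then b z $ i else M z $ i $ j) / det (M z))
      :: real^'n)"
  proof (intro continuous_intros continuous_on_det assms)
    fix k i j
    show "continuous_on S (\<lambda>z. if j = k then b z $ i else M z $ i $ j)"
      by (cases "j = k") (auto intro!: continuous_intros assms)
  qed (use assms in auto)
  then show ?thesis
    by (rule continuous_on_eq)
      (use assms(3) cramer[THEN iffD1, OF _ matrix_inv_vector(1), symmetric] in blast)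
qed

lemma continuous_on_mat: "continuous_on S f \<Longrightarrow> continuous_on S (\<lambda>z. mat (f z) :: real^'n^'n)"
  unfolding mat_def
proof (intro continuous_intros)
  fix i j :: 'n
  assume "continuous_on S f"
  then show "continuous_on S (\<lambda>z. if i = j then f z else 0)"
    by (cases "i = j") auto
qed

lemma open_det_mat_diff_nonzero:
  fixes A :: "real^'n^'n"
  shows "open {l. det (mat l - A) \<noteq> 0}"
  by (intro open_Collect_neq continuous_on_det continuous_intros continuous_on_mat)

text \<open>The first resolvent identity, from \<open>mat m - A = (mat l - A) + (m - l) I\<close>.
  It displays the factor \<open>m - l\<close> that cancels in difference quotients.\<close>

lemma resolvent_diff:
  fixes A :: "real^'n^'n"
  assumes "det (mat l - A) \<noteq> 0" "det (mat m - A) \<noteq> 0"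
  shows "matrix_inv (mat l - A) *v b - matrix_inv (mat m - A) *v b =
    (m - l) *\<^sub>R (matrix_inv (mat l - A) *v (matrix_inv (mat m - A) *v b))"
proof -
  define y where "y = matrix_inv (mat m - A) *v b"
  have "b = (mat m - A) *v y"
    by (simp add: y_def matrix_inv_vector assms)
  also have "\<dots> = (mat l - A) *v y + (m - l) *\<^sub>R y"
    by (simp add: mat_diff_vector_mult scalar_mult_eq_scaleR scaleR_left_diff_distrib)
  finally have "matrix_inv (mat l - A) *v b =
      matrix_inv (mat l - A) *v ((mat l - A) *v y + (m - l) *\<^sub>R y)"
    by simp
  then show ?thesis
    unfolding y_def[symmetric]
    by (simp add: matrix_vector_right_distrib matrix_vector_mult_scaleR matrix_inv_vector assms)
qed

text \<open>By the resolvent identity both difference quotients are, off \<open>m\<close>, equal to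
  products of resolvents that are continuous in \<open>l\<close> also at \<open>m\<close>. The
  derivatives are the values of these products at \<open>m\<close>.\<close>

lemma
  fixes A :: "real^'n^'n"
  assumes m: "det (mat m - A) \<noteq> 0"
  shows DERIV_resolvent: "((\<lambda>l. v \<bullet> (matrix_inv (mat l - A) *v b)) has_real_derivative
      - (v \<bullet> (matrix_inv (mat m - A) *v (matrix_inv (mat m - A) *v b)))) (at m)" (is ?th1)
    and DERIV_resolvent_square:
      "((\<lambda>l. v \<bullet> (matrix_inv (mat l - A) *v (matrix_inv (mat l - A) *v b))) has_real_derivative
      - 2 * (v \<bullet> (matrix_inv (mat m - A) *v (matrix_inv (mat m - A) *v
        (matrix_inv (mat m - A) *v b))))) (at m)" (is ?th2)
proof -
  define U where "U = {l. det (mat l - A) \<noteq> 0}"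
  define R where "R l = (*v) (matrix_inv (mat l - A))" for l
  have R: "R l b - R m b = (m - l) *\<^sub>R R l (R m b)" if "l \<in> U" for l b
    using that m unfolding R_def U_def by (simp add: resolvent_diff)
  have R_diff: "R l b - R l c = R l (b - c)" for l b c
    by (simp add: R_def matrix_vector_mult_diff_distrib)
  have R_scale: "R l (r *\<^sub>R c) = r *\<^sub>R R l c" for l r c
    by (simp add: R_def matrix_vector_mult_scaleR)
  have "open U"
    unfolding U_def by (rule open_det_mat_diff_nonzero)
  moreover have "m \<in> U"
    using m by (simp add: U_def)
  ultimately have ev: "\<forall>\<^sub>F l in at m. l \<in> U \<and> l \<noteq> m"
    by (simp add: eventually_at_topological) blast
  have cR: "continuous_on U (\<lambda>l. R l (f l))" if "continuous_on U f" for f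
    unfolding R_def using that
    by (intro continuous_on_matrix_inv_vector continuous_intros continuous_on_mat)
      (auto simp: U_def)
  have lim: "(f \<longlongrightarrow> f m) (at m)" if "continuous_on U f" for f :: "real \<Rightarrow> real"
    using that \<open>open U\<close> \<open>m \<in> U\<close> by (simp add: continuous_on_eq_continuous_at isCont_def)
  have 1: "((\<lambda>l. - (v \<bullet> R l (R m b))) \<longlongrightarrow> - (v \<bullet> R m (R m b))) (at m)"
    by (rule lim) (intro continuous_intros cR)
  have e1: "\<forall>\<^sub>F l in at m. - (v \<bullet> R l (R m b)) = (v \<bullet> R l b - v \<bullet> R m b) / (l - m)"
    using ev
  proof eventually_elim
    case (elim l)
    then have "v \<bullet> R l b - v \<bullet> R m b = (m - l) * (v \<bullet> R l (R m b))"
      by (simp add: R flip: inner_diff_right)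
    then show ?case
      using elim by (simp add: field_simps)
  qed
  show ?th1
    unfolding has_field_derivative_iff using Lim_transform_eventually[OF 1 e1]
    by (simp add: R_def)
  have 2: "((\<lambda>l. - (v \<bullet> R l (R m (R l b))) - (v \<bullet> R m (R l (R m b))))
      \<longlongrightarrow> - (v \<bullet> R m (R m (R m b))) - (v \<bullet> R m (R m (R m b)))) (at m)"
  proof (rule lim)
    have cRm: "continuous_on U (\<lambda>l. R m (f l))" if "continuous_on U f" for f
      unfolding R_def using m that
      by (intro continuous_on_matrix_inv_vector continuous_intros)
    show "continuous_on U (\<lambda>l. - (v \<bullet> R l (R m (R l b))) - (v \<bullet> R m (R l (R m b))))"
      by (intro continuous_intros cR cRm)
  qed
  have e2: "\<forall>\<^sub>F l in at m. - (v \<bullet> R l (R m (R l b))) - (v \<bullet> R m (R l (R m b))) =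
      (v \<bullet> R l (R l b) - v \<bullet> R m (R m b)) / (l - m)"
    using ev
  proof eventually_elim
    case (elim l)
    \<comment> \<open>The telescoping of the product rule: one resolvent factor is changed at a
      time.\<close>
    have "R l (R l b) - R m (R m b) = (R l (R l b) - R m (R l b)) + (R m (R l b) - R m (R m b))"
      by simp
    also have "\<dots> = (m - l) *\<^sub>R (R l (R m (R l b)) + R m (R l (R m b)))"
      using elim by (simp only: R R_diff R_scale scaleR_right_distrib)
    finally have "v \<bullet> R l (R l b) - v \<bullet> R m (R m b) =
        (m - l) * (v \<bullet> R l (R m (R l b)) + v \<bullet> R m (R l (R m b)))"
      by (simp add: inner_add_right flip: inner_diff_right)
    then show ?case
      using elim by (simp add: field_simps)
  qed
  show ?th2
    unfolding has_field_derivative_iff using Lim_transform_eventually[OF 2 e2]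
    by (simp add: R_def)
qed

lemma
  fixes A :: "real^'n^'n"
  assumes l: "\<not> eigenvalue A l"
  shows DERIV_Q: "(Q A u v has_real_derivative
      - (v \<bullet> (matrix_inv (mat l - A) *v (matrix_inv (mat l - A) *v u)))) (at l)"
    and DERIV_deriv_Q: "(deriv (Q A u v) has_real_derivative
      2 * (v \<bullet> (matrix_inv (mat l - A) *v (matrix_inv (mat l - A) *v
        (matrix_inv (mat l - A) *v u))))) (at l)"
proof -
  have Q': "(Q A u v has_real_derivative
      - (v \<bullet> (matrix_inv (mat l - A) *v (matrix_inv (mat l - A) *v u)))) (at l)"
    if "det (mat l - A) \<noteq> 0" for l
    using DERIV_resolvent[OF that] by (simp add: Q_def[abs_def])
  have nz: "det (mat l - A) \<noteq> 0"
    using l by (simp add: eigenvalue_iff_det)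
  show "(Q A u v has_real_derivative
      - (v \<bullet> (matrix_inv (mat l - A) *v (matrix_inv (mat l - A) *v u)))) (at l)"
    by (rule Q'[OF nz])
  \<comment> \<open>A second differentiation needs the formula for \<open>deriv (Q A u v)\<close> on
    a whole neighbourhood; the complement of the spectrum is open and provides one.\<close>
  have "\<forall>\<^sub>F l in nhds l. det (mat l - A) \<noteq> 0"
    using eventually_nhds_in_open[OF open_det_mat_diff_nonzero, of l A] nz by simp
  then have "\<forall>\<^sub>F l in nhds l. deriv (Q A u v) l =
      - (v \<bullet> (matrix_inv (mat l - A) *v (matrix_inv (mat l - A) *v u)))"
    by eventually_elim (rule DERIV_imp_deriv[OF Q'])
  then show "(deriv (Q A u v) has_real_derivative
      2 * (v \<bullet> (matrix_inv (mat l - A) *v (matrix_inv (mat l - A) *v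
        (matrix_inv (mat l - A) *v u))))) (at l)"
    using DERIV_minus[OF DERIV_resolvent_square[OF nz]]
    by (subst DERIV_cong_ev[OF refl _ refl]) auto
qed

section \<open>A scalar implicit function theorem\<close>

text \<open>On a small box \<open>F\<close> is strictly increasing in \<open>l\<close>, and its sign
  change across \<open>x0\<close> persists for \<open>p\<close> near \<open>p0\<close>, so each such
  \<open>p\<close> has exactly one zero. Differentiability is assumed in \<open>l\<close> only;
  continuity of \<open>X\<close> comes from compactness.\<close>

lemma implicit_function_real_pos:
  fixes F F' :: "'a::euclidean_space \<times> real \<Rightarrow> real"
  assumes "open U" "(p0, x0) \<in> U" "F (p0, x0) = 0" "F' (p0, x0) > 0"
    and cF: "continuous_on U F" and cF': "continuous_on U F'"
    and deriv: "\<And>p l. (p, l) \<in> U \<Longrightarrow> ((\<lambda>l. F (p, l)) has_real_derivative F' (p, l)) (at l)"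
  obtains \<delta> X where "\<delta> > 0" "continuous_on (ball p0 \<delta>) X" "X p0 = x0"
    "\<And>p. p \<in> ball p0 \<delta> \<Longrightarrow> (p, X p) \<in> U \<and> F (p, X p) = 0 \<and> F' (p, X p) > 0"
proof -
  have "open (U \<inter> F' -` {0<..})"
    by (rule continuous_open_preimage[OF cF' \<open>open U\<close>]) simp
  moreover have "(p0, x0) \<in> U \<inter> F' -` {0<..}"
    using assms by simp
  ultimately obtain V W where VW: "open V" "open W" "(p0, x0) \<in> V \<times> W"
    "V \<times> W \<subseteq> U \<inter> F' -` {0<..}"
    by (rule open_prod_elim)
  obtain d where d: "d > 0" "ball p0 d \<subseteq> V"
    using VW by (meson open_contains_ball mem_Sigma_iff)
  obtain e where e: "e > 0" "cball x0 e \<subseteq> W"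
    using VW by (meson open_contains_cball mem_Sigma_iff)
  define I where "I = {x0 - e..x0 + e}"
  have I: "I = cball x0 e"
    by (simp add: I_def cball_eq_atLeastAtMost)
  have box: "(p, l) \<in> U" "F' (p, l) > 0" if "p \<in> ball p0 d" "l \<in> I" for p l
    using that d e VW unfolding I by blast+
  have mono: "F (p, a) < F (p, b)" if "p \<in> ball p0 d" "a \<in> I" "b \<in> I" "a < b" for p a b
  proof (rule DERIV_pos_imp_increasing[where f = "\<lambda>l. F (p, l)"])
    fix y assume "a \<le> y" "y \<le> b"
    then have "y \<in> I"
      using that by (auto simp: I_def)
    then show "\<exists>D. ((\<lambda>l. F (p, l)) has_real_derivative D) (at y) \<and> 0 < D"
      using box[OF that(1)] deriv by blast
  qed (rule that)
  have p0: "p0 \<in> ball p0 d" and ends: "x0 - e \<in> I" "x0 \<in> I" "x0 + e \<in> I"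
    using d e by (auto simp: I_def)
  have "F (p0, x0 - e) < 0" "0 < F (p0, x0 + e)"
    using mono[OF p0, of "x0 - e" x0] mono[OF p0, of x0 "x0 + e"] ends e \<open>F (p0, x0) = 0\<close> by auto
  have cont: "continuous_on (ball p0 d) (\<lambda>p. F (p, l))" if "l \<in> I" for l
    by (rule continuous_on_compose2[OF cF]) (use box that in \<open>auto intro!: continuous_intros\<close>)
  \<comment> \<open>The parameters for which \<open>F\<close> keeps its strict signs at the two ends
    of \<open>I\<close>. The intermediate value theorem then yields a zero in between.\<close>
  define N where "N = (ball p0 d \<inter> (\<lambda>p. F (p, x0 - e)) -` {..<0}) \<inter>
    (ball p0 d \<inter> (\<lambda>p. F (p, x0 + e)) -` {0<..})"
  have "open N"
    unfolding N_def using ends by (intro open_Int continuous_open_preimage cont) auto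
  moreover have "p0 \<in> N"
    using p0 \<open>F (p0, x0 - e) < 0\<close> \<open>0 < F (p0, x0 + e)\<close> by (simp add: N_def)
  ultimately obtain \<delta> where \<delta>: "\<delta> > 0" "ball p0 \<delta> \<subseteq> N"
    by (meson open_contains_ball)
  have sub: "ball p0 \<delta> \<subseteq> ball p0 d"
    using \<delta> by (auto simp: N_def)
  have "\<exists>l\<in>I. F (p, l) = 0" if p: "p \<in> ball p0 \<delta>" for p
  proof -
    have "F (p, x0 - e) < 0" "0 < F (p, x0 + e)"
      using p \<delta> by (auto simp: N_def)
    moreover have "continuous_on I (\<lambda>l. F (p, l))"
      by (rule continuous_on_compose2[OF cF]) (use box p sub in \<open>auto intro!: continuous_intros\<close>)
    ultimately show ?thesis
      using IVT'[of "\<lambda>l. F (p, l)" "x0 - e" 0 "x0 + e"] e by (auto simp: I_def)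
  qed
  then obtain X where X: "\<And>p. p \<in> ball p0 \<delta> \<Longrightarrow> X p \<in> I \<and> F (p, X p) = 0"
    by metis
  have unique: "l = X p" if "p \<in> ball p0 \<delta>" "l \<in> I" "F (p, l) = 0" for p l
  proof -
    have "p \<in> ball p0 d"
      using that sub by auto
    then show ?thesis
      using mono[of p l "X p"] mono[of p "X p" l] X[OF that(1)] that by force
  qed
  \<comment> \<open>By uniqueness the graph of \<open>X\<close> is the whole zero set of
    \<open>F\<close> over the ball, hence closed. A function into the compact interval
    \<open>I\<close> with closed graph is continuous.\<close>
  have "(\<lambda>p. (p, X p)) ` ball p0 \<delta> = {z \<in> ball p0 \<delta> \<times> I. F z = 0}"
    using X unique by force
  moreover have "continuous_on (ball p0 \<delta> \<times> I) F"
    by (rule continuous_on_subset[OF cF]) (use box sub in auto)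
  ultimately have "closedin (top_of_set (ball p0 \<delta> \<times> I)) ((\<lambda>p. (p, X p)) ` ball p0 \<delta>)"
    by (simp add: continuous_closedin_preimage_constant)
  then have "continuous_on (ball p0 \<delta>) X"
    using X by (subst continuous_closed_graph_eq[of I]) (auto simp: I)
  moreover have "X p0 = x0"
    using unique[of p0 x0] ends \<delta> assms by simp
  moreover have "(p, X p) \<in> U \<and> F (p, X p) = 0 \<and> F' (p, X p) > 0" if "p \<in> ball p0 \<delta>" for p
    using box[of p "X p"] X[OF that] sub that by blast
  ultimately show thesis
    using \<delta>(1) by (intro that[of \<delta> X])
qed

text \<open>A negative slope is reduced to the positive case by passing to \<open>- F\<close> and
  \<open>- F'\<close>, which leaves the zeros unchanged.\<close>

lemma implicit_function_real:
  fixes F F' :: "'a::euclidean_space \<times> real \<Rightarrow> real"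
  assumes "open U" "(p0, x0) \<in> U" "F (p0, x0) = 0" "F' (p0, x0) \<noteq> 0"
    and "continuous_on U F" "continuous_on U F'"
    and "\<And>p l. (p, l) \<in> U \<Longrightarrow> ((\<lambda>l. F (p, l)) has_real_derivative F' (p, l)) (at l)"
  obtains \<delta> X where "\<delta> > 0" "continuous_on (ball p0 \<delta>) X" "X p0 = x0"
    "\<And>p. p \<in> ball p0 \<delta> \<Longrightarrow> (p, X p) \<in> U \<and> F (p, X p) = 0 \<and> F' (p, X p) \<noteq> 0"
proof (cases "F' (p0, x0) > 0")
  case True
  then obtain \<delta> X where "\<delta> > 0" "continuous_on (ball p0 \<delta>) X" "X p0 = x0"
    "\<And>p. p \<in> ball p0 \<delta> \<Longrightarrow> (p, X p) \<in> U \<and> F (p, X p) = 0 \<and> F' (p, X p) > 0"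
    using implicit_function_real_pos[of U p0 x0 F F'] assms by metis
  then show ?thesis
    using that by (metis less_irrefl)
next
  case False
  obtain \<delta> X where "\<delta> > 0" "continuous_on (ball p0 \<delta>) X" "X p0 = x0"
    "\<And>p. p \<in> ball p0 \<delta> \<Longrightarrow> (p, X p) \<in> U \<and> - F (p, X p) = 0 \<and> - F' (p, X p) > 0"
  proof (rule implicit_function_real_pos[of U p0 x0 "\<lambda>z. - F z" "\<lambda>z. - F' z"])
    show "- F' (p0, x0) > 0"
      using False assms by auto
  qed (use assms in \<open>auto intro: continuous_on_minus DERIV_minus\<close>)
  then show ?thesis
    using that by (metis less_irrefl neg_equal_0_iff_equal)
qed

section \<open>Critical points of Q are branch points\<close>

text \<open>The real eigenvector also serves over the complex numbers, where
  \<open>analytic_eigenvalues_near\<close> counts eigenvalues.\<close>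

lemma eigenvalue_of_real:
  fixes A :: "real^'n^'n"
  assumes "eigenvalue A l"
  shows "eigenvalue (map_matrix complex_of_real A) (complex_of_real l)"
proof -
  obtain w where w: "w \<noteq> 0" "A *v w = l *s w"
    using assms by (auto simp: eigenvalue_def)
  define w' :: "complex^'n" where "w' = (\<chi> i. complex_of_real (w $ i))"
  have "w' \<noteq> 0"
    using w(1) by (auto simp: w'_def vec_eq_iff)
  moreover have "map_matrix complex_of_real A *v w' = complex_of_real l *s w'"
    using w(2) by (simp add: w'_def vec_eq_iff matrix_vector_mult_def flip: of_real_mult of_real_sum)
  ultimately show ?thesis
    by (auto simp: eigenvalue_def)
qed

text \<open>The eigenvector is \<open>w = (l I - A)^(-1) u\<close>: here
  \<open>A w = l w - u\<close>, and the perturbation contributes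
  \<open>(v \<bullet> w) / Q = 1\<close> times \<open>u\<close>, which cancels \<open>- u\<close>.
  As \<open>v \<bullet> w = Q\<close> is nonzero, so is \<open>w\<close>.\<close>

lemma eigenvalue_rank_one_perturbation:
  fixes A :: "real^'n^'n"
  assumes "\<not> eigenvalue A l" "Q A u v l \<noteq> 0"
  shows "eigenvalue (A + (1 / Q A u v l) *\<^sub>R rank_one u v) l"
proof -
  define w where "w = matrix_inv (mat l - A) *v u"
  have Q: "Q A u v l = v \<bullet> w"
    by (simp add: Q_def w_def)
  have "w \<noteq> 0"
    using assms(2) by (auto simp: Q)
  have "u = (mat l - A) *v w"
    using assms(1) by (simp add: w_def matrix_inv_vector eigenvalue_iff_det)
  also have "\<dots> = l *s w - A *v w"
    by (rule mat_diff_vector_mult)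
  finally have "A *v w + u = l *s w"
    by simp
  moreover have "rank_one u v *v w = (v \<bullet> w) *\<^sub>R u"
    by (simp add: rank_one_def matrix_vector_mult_def vec_eq_iff inner_vec_def sum_distrib_left
        mult_ac)
  ultimately have "(A + (1 / Q A u v l) *\<^sub>R rank_one u v) *v w = l *s w"
    using assms(2)
    by (simp add: Q matrix_vector_mult_add_rdistrib flip: scaleR_matrix_vector_assoc)
  with \<open>w \<noteq> 0\<close> show ?thesis
    by (auto simp: eigenvalue_def)
qed

text \<open>A zero with nonzero slope is isolated, because the difference quotient tends to
  \<open>D\<close>; at a point that is not a zero, continuity suffices.\<close>

lemma DERIV_nonzero_imp_eventually_nonzero:
  fixes f :: "real \<Rightarrow> real"
  assumes "(f has_real_derivative D) (at x)" "D \<noteq> 0"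
  shows "\<forall>\<^sub>F y in at x. f y \<noteq> 0"
proof (cases "f x = 0")
  case True
  then have "((\<lambda>y. f y / (y - x)) \<longlongrightarrow> D) (at x)"
    using assms(1) by (simp add: has_field_derivative_iff)
  then have "\<forall>\<^sub>F y in at x. f y / (y - x) \<noteq> 0"
    using assms(2) tendsto_imp_eventually_ne by blast
  then show ?thesis
    by eventually_elim auto
next
  case False
  have "isCont f x"
    using assms(1) by (rule DERIV_isCont)
  then show ?thesis
    using False isContD tendsto_imp_eventually_ne by blast
qed

text \<open>Near a critical point \<open>x\<close> the real numbers \<open>l\<close> are eigenvalues for the parameter
  \<open>t l = 1 / Q l\<close>, whose derivative vanishes at \<open>x\<close>. So if \<open>\<Lambda>\<close> is differentiable at \<open>t x\<close>, then
  \<open>\<Lambda> (t l) - l\<close> has derivative \<open>-1\<close> at \<open>x\<close>, and \<open>\<Lambda>\<close> misses all these eigenvalues close to \<open>x\<close>.\<close>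
lemma not_analytic_eigenvalues_near_critical_point:
  fixes A :: "real^'n^'n"
  assumes "t0 \<noteq> 0" "\<not> eigenvalue A x" "Q A u v x = 1 / t0"
    and Q': "(Q A u v has_real_derivative 0) (at x)"
  shows "\<not> analytic_eigenvalues_near (\<lambda>t. A + t *\<^sub>R rank_one u v) t0 (complex_of_real x)"
proof
  assume "analytic_eigenvalues_near (\<lambda>t. A + t *\<^sub>R rank_one u v) t0 (complex_of_real x)"
  then obtain k \<Lambda> r where "r > 0"
    and analytic: "\<And>i. i < k \<Longrightarrow> \<Lambda> i analytic_on {complex_of_real t0}"
    and enum: "\<forall>\<^sub>F t in nhds t0. {l \<in> ball (complex_of_real x) r.
        eigenvalue (map_matrix complex_of_real (A + t *\<^sub>R rank_one u v)) l} =
      {\<Lambda> i (complex_of_real t) | i. i < (k::nat)}"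
    unfolding analytic_eigenvalues_near_def by blast
  define t where "t l = 1 / Q A u v l" for l
  have nz: "Q A u v x \<noteq> 0" and tx: "t x = t0"
    using assms by (auto simp: t_def)
  have t': "(t has_real_derivative 0) (at x)"
    unfolding t_def[abs_def] using Q' nz by (auto intro!: derivative_eq_intros)
  then have "(t \<longlongrightarrow> t0) (at x)"
    using DERIV_isCont[of t] tx by (auto simp: isCont_def)
  then have "filterlim t (nhds t0) (at x)" .
  \<comment> \<open>The enumeration is pulled back along \<open>t\<close>. It holds on a full
    neighbourhood of \<open>t0\<close>, so a value \<open>t l = t0\<close> does no harm.\<close>
  then have enum': "\<forall>\<^sub>F l in at x. {z \<in> ball (complex_of_real x) r.
        eigenvalue (map_matrix complex_of_real (A + t l *\<^sub>R rank_one u v)) z} =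
      {\<Lambda> i (complex_of_real (t l)) | i. i < k}"
    using enum by (rule eventually_compose_filterlim[rotated])
  \<comment> \<open>The target \<open>l\<close> is real, so it is enough to compare real parts,
    which gives a real function of \<open>l\<close>.\<close>
  have "\<forall>\<^sub>F l in at x. Re (\<Lambda> i (complex_of_real (t l))) - l \<noteq> 0" if "i < k" for i
  proof (rule DERIV_nonzero_imp_eventually_nonzero)
    obtain D where "(\<Lambda> i has_field_derivative D) (at (complex_of_real (t x)))"
      using analytic_on_imp_differentiable_at[OF analytic, of i] \<open>i < k\<close> tx
      by (auto simp: field_differentiable_def)
    moreover have "((\<lambda>l. complex_of_real (t l)) has_vector_derivative 0) (at x)"
      using has_vector_derivative_of_real[OF t'] by simp
    \<comment> \<open>Whatever \<open>D\<close> is, the chain rule multiplies it by the vanishing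
      derivative of \<open>t\<close>.\<close>
    ultimately have "((\<lambda>l. \<Lambda> i (complex_of_real (t l))) has_vector_derivative 0) (at x)"
      using field_vector_diff_chain_at[of "\<lambda>l. complex_of_real (t l)" 0 x "\<Lambda> i" D]
      by (simp add: o_def)
    then have "((\<lambda>l. Re (\<Lambda> i (complex_of_real (t l)))) has_vector_derivative Re 0) (at x)"
      by (rule bounded_linear.has_vector_derivative[OF bounded_linear_Re])
    then have "((\<lambda>l. Re (\<Lambda> i (complex_of_real (t l)))) has_real_derivative 0) (at x)"
      by (simp add: has_real_derivative_iff_has_vector_derivative)
    from DERIV_diff[OF this DERIV_ident]
    show "((\<lambda>l. Re (\<Lambda> i (complex_of_real (t l))) - l) has_real_derivative -1) (at x)"
      by simp
  qed simp
  \<comment> \<open>Finitely many branches, so one punctured neighbourhood of \<open>x\<close>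
    serves them all.\<close>
  then have missed: "\<forall>\<^sub>F l in at x. \<forall>i\<in>{..<k}. Re (\<Lambda> i (complex_of_real (t l))) - l \<noteq> 0"
    by (intro eventually_ball_finite) auto
  have "\<forall>\<^sub>F l in at x. Q A u v l \<noteq> 0"
    using DERIV_isCont[OF Q'] nz isContD tendsto_imp_eventually_ne by blast
  moreover have "\<forall>\<^sub>F l in at x. \<not> eigenvalue A l"
    using open_det_mat_diff_nonzero[of A] assms(2)
    by (auto simp: eigenvalue_iff_det eventually_at_topological)
  moreover have "\<forall>\<^sub>F l in at x. dist x l < r"
    using \<open>r > 0\<close> by (auto simp: eventually_at dist_commute)
  \<comment> \<open>Each \<open>l\<close> close to but different from \<open>x\<close> is an
    eigenvalue for the parameter \<open>t l\<close>, hence listed by some branch, yet all branches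
    miss it. The filter \<open>at x\<close> on the reals is nontrivial, so this is absurd.\<close>
  ultimately have "\<forall>\<^sub>F l in at x. False"
    using enum' missed
  proof eventually_elim
    case (elim l)
    have "eigenvalue (map_matrix complex_of_real (A + t l *\<^sub>R rank_one u v)) (complex_of_real l)"
      unfolding t_def using elim by (intro eigenvalue_of_real eigenvalue_rank_one_perturbation)
    moreover have "complex_of_real l \<in> ball (complex_of_real x) r"
      using elim by (simp add: dist_norm flip: of_real_diff)
    ultimately obtain i where "i < k" "complex_of_real l = \<Lambda> i (complex_of_real (t l))"
      using elim by blast
    then have "Re (\<Lambda> i (complex_of_real (t l))) - l = 0"
      by (metis Re_complex_of_real diff_self)
    with elim \<open>i < k\<close> show False
      by blast
  qed
  then show False
    by (simp add: eventually_False)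
qed

section \<open>Persistence of critical points of \<open>Q\<close> under perturbation of the
  data\<close>

theorem theorem13:
  fixes A :: "real^'n^'n" and u v :: "real^'n" and \<tau>0 x :: real
  assumes "\<tau>0 > 0"
    and "\<not> eigenvalue A x"
    and "Q A u v x = 1 / \<tau>0"
    and "deriv (Q A u v) x = 0"
    and "deriv (deriv (Q A u v)) x \<noteq> 0"
  shows "\<exists>\<delta>>0. \<exists>X T :: (real^'n^'n) \<times> (real^'n) \<times> (real^'n) \<Rightarrow> real.
    (let S = {(A', u', v'). norm (A' - A) < \<delta> \<and> norm (u' - u) < \<delta> \<and> norm (v' - v) < \<delta>} in
      continuous_on S X \<and> continuous_on S T \<and> X (A, u, v) = x \<and> T (A, u, v) = \<tau>0 \<and>
      (\<forall>(A', u', v') \<in> S.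
        let x' = X (A', u', v'); \<tau>0' = T (A', u', v') in
          \<tau>0' > 0 \<and>
          \<not> eigenvalue A' x' \<and>
          Q A' u' v' x' = 1 / \<tau>0' \<and>
          deriv (Q A' u' v') x' = 0 \<and>
          deriv (deriv (Q A' u' v')) x' \<noteq> 0 \<and>
          \<not> analytic_eigenvalues_near (\<lambda>\<tau>. A' + \<tau> *\<^sub>R rank_one u' v') \<tau>0'
              (complex_of_real x')))"
proof -
  let ?p0 = "(A, u, v)"
  \<comment> \<open>A point \<open>z\<close> is \<open>((A', u', v'), l)\<close>. Off the spectrum,
    on \<open>V\<close>, the functions \<open>G\<close>, \<open>F\<close> and \<open>F'\<close> are
    \<open>Q\<close>, its first and its second derivative in \<open>l\<close>, now as functions of
    all data jointly.\<close>
  define R where "R z b = matrix_inv (mat (snd z) - fst (fst z)) *v b"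
    for z :: "((real^'n^'n) \<times> (real^'n) \<times> (real^'n)) \<times> real" and b
  define V where "V = {z :: ((real^'n^'n) \<times> (real^'n) \<times> (real^'n)) \<times> real.
    det (mat (snd z) - fst (fst z)) \<noteq> 0}"
  define G where "G z = snd (snd (fst z)) \<bullet> R z (fst (snd (fst z)))" for z
  define F where "F z = - (snd (snd (fst z)) \<bullet> R z (R z (fst (snd (fst z)))))" for z
  define F' where "F' z = 2 * (snd (snd (fst z)) \<bullet> R z (R z (R z (fst (snd (fst z))))))" for z
  \<comment> \<open>Requiring \<open>G > 0\<close> already here keeps the new parameter
    \<open>1 / G\<close> positive and continuous along the zeros.\<close>
  define U where "U = V \<inter> G -` {0<..}"
  have cR: "continuous_on V (\<lambda>z. R z (f z))" if "continuous_on V f" for f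
    unfolding R_def using that
    by (intro continuous_on_matrix_inv_vector continuous_intros continuous_on_mat)
      (auto simp: V_def)
  have cG: "continuous_on V G" and cF: "continuous_on V F" and cF': "continuous_on V F'"
    unfolding G_def F_def F'_def by (intro continuous_intros cR)+
  have "open V"
    unfolding V_def by (intro open_Collect_neq continuous_on_det continuous_intros continuous_on_mat)
  then have "open U"
    unfolding U_def by (intro continuous_open_preimage cG) auto
  have V: "((A', u', v'), l) \<in> V \<longleftrightarrow> \<not> eigenvalue A' l" for A' u' v' l
    by (simp add: V_def eigenvalue_iff_det)
  have G: "G ((A', u', v'), l) = Q A' u' v' l" for A' u' v' l
    by (simp add: G_def R_def Q_def)
  have Q': "(Q A' u' v' has_real_derivative F ((A', u', v'), l)) (at l)"
    and Q'': "(deriv (Q A' u' v') has_real_derivative F' ((A', u', v'), l)) (at l)"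
    if "((A', u', v'), l) \<in> V" for A' u' v' l
    using DERIV_Q[of A' l u' v'] DERIV_deriv_Q[of A' l u' v'] that
    by (simp_all add: V F_def F'_def R_def)
  obtain d X where d: "d > 0" and X: "continuous_on (ball ?p0 d) X" "X ?p0 = x"
    "\<And>p. p \<in> ball ?p0 d \<Longrightarrow> (p, X p) \<in> U \<and> F (p, X p) = 0 \<and> F' (p, X p) \<noteq> 0"
  proof (rule implicit_function_real[OF \<open>open U\<close>])
    have "(?p0, x) \<in> V"
      using assms by (simp add: V)
    then show "F (?p0, x) = 0" "F' (?p0, x) \<noteq> 0"
      using DERIV_imp_deriv[OF Q'] DERIV_imp_deriv[OF Q''] assms by auto
    show "(?p0, x) \<in> U"
      using \<open>(?p0, x) \<in> V\<close> assms by (simp add: U_def G)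
    show "continuous_on U F" "continuous_on U F'"
      using cF cF' by (auto simp: U_def intro: continuous_on_subset)
    fix p l assume pl: "(p, l) \<in> U"
    obtain A' u' v' where p: "p = (A', u', v')"
      by (cases p)
    \<comment> \<open>For fixed \<open>p\<close>, \<open>F\<close> agrees with
      \<open>deriv (Q A' u' v')\<close> near \<open>l\<close>, so the second derivative of
      \<open>Q\<close> is the slope of \<open>F\<close>.\<close>
    have "\<forall>\<^sub>F l in nhds l. (p, l) \<in> V"
      using eventually_nhds_in_open[OF open_det_mat_diff_nonzero, of l "fst p"] pl
      by (simp add: U_def V_def)
    then have "\<forall>\<^sub>F l in nhds l. F (p, l) = deriv (Q A' u' v') l"
      by eventually_elim (use DERIV_imp_deriv[OF Q'] p in auto)
    then show "((\<lambda>l. F (p, l)) has_real_derivative F' (p, l)) (at l)"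
      using Q'' pl p by (subst DERIV_cong_ev[OF refl _ refl]) (auto simp: U_def)
  qed blast
  \<comment> \<open>The value forced by the equation \<open>Q = 1 / \<tau>0'\<close> at the
    displaced critical point.\<close>
  define T where "T p = 1 / G (p, X p)" for p
  \<comment> \<open>With \<open>d / 3\<close> for each component, the triangle inequality bounds the
    product norm by \<open>d\<close>, which places \<open>S\<close> inside the ball where
    \<open>X\<close> is controlled.\<close>
  define S where "S = {(A', u', v'). norm (A' - A) < d / 3 \<and> norm (u' - u) < d / 3 \<and>
    norm (v' - v) < d / 3}"
  have S: "S \<subseteq> ball ?p0 d"
  proof safe
    fix A' u' v' assume p: "(A', u', v') \<in> S"
    have "norm (A' - A, u' - u, v' - v) \<le> norm (A' - A) + (norm (u' - u) + norm (v' - v))"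
      by (meson add_left_mono norm_Pair_le order_trans)
    with p have "dist (A', u', v') ?p0 < d"
      by (simp add: S_def dist_norm)
    then show "(A', u', v') \<in> ball ?p0 d"
      by (simp add: dist_commute)
  qed
  have cX: "continuous_on S X"
    using X(1) S by (rule continuous_on_subset)
  have XU: "(p, X p) \<in> U" if "p \<in> S" for p
    using X(3)[of p] S that by blast
  have "continuous_on S (\<lambda>p. G (p, X p))"
    by (rule continuous_on_compose2[OF cG])
      (use cX XU in \<open>auto intro!: continuous_intros simp: U_def\<close>)
  moreover have "G (p, X p) \<noteq> 0" if "p \<in> S" for p
    using XU[OF that] by (auto simp: U_def)
  ultimately have cT: "continuous_on S T"
    unfolding T_def[abs_def] by (intro continuous_intros) auto
  have T0: "T ?p0 = \<tau>0"
    using assms(3) by (simp add: T_def G X(2))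
  have main: "let x' = X (A', u', v'); \<tau>0' = T (A', u', v') in
          \<tau>0' > 0 \<and>
          \<not> eigenvalue A' x' \<and>
          Q A' u' v' x' = 1 / \<tau>0' \<and>
          deriv (Q A' u' v') x' = 0 \<and>
          deriv (deriv (Q A' u' v')) x' \<noteq> 0 \<and>
          \<not> analytic_eigenvalues_near (\<lambda>\<tau>. A' + \<tau> *\<^sub>R rank_one u' v') \<tau>0'
              (complex_of_real x')"
    if p: "(A', u', v') \<in> S" for A' u' v'
  proof -
    let ?l = "X (A', u', v')"
    have U: "((A', u', v'), ?l) \<in> U" and F: "F ((A', u', v'), ?l) = 0"
      and F': "F' ((A', u', v'), ?l) \<noteq> 0"
      using X(3) S p by auto
    have inV: "((A', u', v'), ?l) \<in> V" and pos: "Q A' u' v' ?l > 0"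
      using U by (auto simp: U_def G)
    have T: "T (A', u', v') = 1 / Q A' u' v' ?l"
      by (simp add: T_def G)
    have "\<not> analytic_eigenvalues_near (\<lambda>\<tau>. A' + \<tau> *\<^sub>R rank_one u' v') (T (A', u', v'))
        (complex_of_real ?l)"
      using inV pos T Q'[OF inV] F
      by (intro not_analytic_eigenvalues_near_critical_point) (auto simp: V)
    then show ?thesis
      using inV pos T F F' DERIV_imp_deriv[OF Q'[OF inV]] DERIV_imp_deriv[OF Q''[OF inV]]
      by (simp add: V Let_def)
  qed
  show ?thesis
  proof (rule exI[of _ "d / 3"], rule conjI)
    show "d / 3 > 0"
      using d by simp
  qed (rule exI[of _ X], rule exI[of _ T], fold S_def, unfold Let_def, intro conjI ballI,
      (fact cX cT X(2) T0
        | (simp only: split_paired_all case_prod_conv, rule main[unfolded Let_def], assumption))+)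
qed

end
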